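(* Let $0<q<1$ and $\alpha>-1$. For every $n\in\mathbb{N}_0$ and every $z\in\mathbb{C}$, the generalized $q$-Bernoulli polynomial $B^{(2)}_{n,\alpha}(z;q)$ satisfies $$B^{(2)}_{n,\alpha}(z;q)=(-1)^n\det A_n,$$ where $A_n=(a_{ij})_{i,j=0}^{n}$ is the $(n+1)\times(n+1)$ matrix whose entries are, for $j\in\{0,1,\dots,n\}$, $$a_{0j}=q^{\frac{j(j-1)}{2}}z^j,\qquad a_{ij}=\begin{bmatrix} j\\ i-1\end{bmatrix}_q\frac{1}{2^{j-i+1}}\,\frac{(q^{2\alpha+1};q^2)_{j-i+1}}{(q^{2\alpha+1};q)_{j-i+1}}\quad(1\le i\le n),$$ with the convention that $\begin{bmatrix} j\\ i-1\end{bmatrix}_q=0$, and hence $a_{ij}=0$, when $i-1>j$.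
   Context: Notation: $(a;q)_n=\prod_{k=0}^{n-1}(1-aq^k)$ and $(a;q)_0=1$; $[n]_q=\frac{1-q^n}{1-q}$; $[n]_q!=\prod_{k=1}^n[k]_q$; $\begin{bmatrix} n\\ k\end{bmatrix}_q=\frac{(q;q)_n}{(q;q)_k(q;q)_{n-k}}$ for $0\le k\le n$, and $\begin{bmatrix} n\\ k\end{bmatrix}_q=0$ for $k>n\ge 0$. $\mathbb{N}_0=\{0,1,2,\dots\}$. The $q$-exponential is $E_q(z)=\sum_{n\ge0}q^{n(n-1)/2}\frac{z^n}{[n]_q!}$ for $z\in\mathbb{C}$. The function $g^{(2)}_\alpha$ (a normalized second Jackson $q$-Bessel function with base $q^2$) is the entire function $$g^{(2)}_\alpha(t;q)=\sum_{n=0}^\infty\frac{(-1)^n\,q^{2n(n+\alpha)}\,(t(1-q)/2)^{2n}}{(q^2;q^2)_n(q^{2\alpha+2};q^2)_n}.$$ The polynomials $B^{(2)}_{n,\alpha}(z;q)$ are defined by the generating function (for $|t|$ sufficiently small) $$\frac{E_q(zt)\,E_q(-t/2)}{g^{(2)}_\alpha(it;q)}=\sum_{n=0}^\infty B^{(2)}_{n,\alpha}(z;q)\frac{t^n}{[n]_q!}.$$ For $\alpha=-\frac12$ the quotient $\frac{(q^{2\alpha+1};q^2)_m}{(q^{2\alpha+1};q)_m}$ with $m\ge1$ is understood after cancelling the common factor $1-q^{2\alpha+1}$, i.e. as $\frac{(q^{2\alpha+3};q^2)_{m-1}}{(q^{2\alpha+2};q)_{m-1}}$. *)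

theory Defs
  imports Complex_Main "Jordan_Normal_Form.Determinant"
begin

definition qpoch :: "'a::comm_ring_1 \<Rightarrow> 'a \<Rightarrow> nat \<Rightarrow> 'a" where
  "qpoch a q n = (\<Prod>k<n. 1 - a * q ^ k)"

definition qnum :: "real \<Rightarrow> nat \<Rightarrow> real" where
  "qnum q n = (1 - q ^ n) / (1 - q)"

definition qfact :: "real \<Rightarrow> nat \<Rightarrow> real" where
  "qfact q n = (\<Prod>k=1..n. qnum q k)"

definition qbinom :: "real \<Rightarrow> nat \<Rightarrow> nat \<Rightarrow> real" where
  "qbinom q n k = (if k \<le> n then qpoch q q n / (qpoch q q k * qpoch q q (n - k)) else 0)"

definition E_q :: "real \<Rightarrow> complex \<Rightarrow> complex" where
  "E_q q z = (\<Sum>n. of_real (q ^ (n * (n - 1) div 2)) * z ^ n / of_real (qfact q n))"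

definition g2 :: "real \<Rightarrow> real \<Rightarrow> complex \<Rightarrow> complex" where
  "g2 q \<alpha> t = (\<Sum>n. (-1) ^ n * of_real (q powr (2 * real n * (real n + \<alpha>)))
      * (t * (1 - of_real q) / 2) ^ (2 * n)
      / of_real (qpoch (q\<^sup>2) (q\<^sup>2) n * qpoch (q powr (2 * \<alpha> + 2)) (q\<^sup>2) n))"

text \<open>For fixed \<open>z\<close>, the sequence of values at \<open>z\<close> of the generalized \<open>q\<close>-Bernoulli polynomials is
  the unique one whose generating series converges to the given quotient near \<open>t = 0\<close>; the radius
  may depend on \<open>z\<close>.\<close>

definition qBernoulli2 :: "real \<Rightarrow> real \<Rightarrow> nat \<Rightarrow> complex \<Rightarrow> complex" where
  "qBernoulli2 q \<alpha> n z =
     (THE b :: nat \<Rightarrow> complex. \<exists>r>0. \<forall>t. norm t < r \<longrightarrow>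
        (\<lambda>m. b m * t ^ m / of_real (qfact q m)) sums
          (E_q q (z * t) * E_q q (- t / 2) / g2 q \<alpha> (\<i> * t))) n"

text \<open>At \<open>\<alpha> = -1/2\<close> and \<open>m \<ge> 1\<close> both Pochhammer symbols contain the vanishing factor
  \<open>1 - q powr (2 * \<alpha> + 1)\<close>, and the quotient is read after cancelling it.\<close>

definition qpoch_ratio :: "real \<Rightarrow> real \<Rightarrow> nat \<Rightarrow> real" where
  "qpoch_ratio q \<alpha> m =
     (if \<alpha> = - 1 / 2 \<and> m \<ge> 1
      then qpoch (q powr (2 * \<alpha> + 3)) (q\<^sup>2) (m - 1) / qpoch (q powr (2 * \<alpha> + 2)) q (m - 1)
      else qpoch (q powr (2 * \<alpha> + 1)) (q\<^sup>2) m / qpoch (q powr (2 * \<alpha> + 1)) q m)"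

text \<open>The index \<open>j - i + 1\<close> is written \<open>j + 1 - i\<close> on the natural numbers. Truncation occurs only
  for \<open>i - 1 > j\<close>, where the \<open>q\<close>-binomial coefficient vanishes.\<close>

definition qBernoulli2_mat :: "real \<Rightarrow> real \<Rightarrow> nat \<Rightarrow> complex \<Rightarrow> complex mat" where
  "qBernoulli2_mat q \<alpha> n z = Matrix.mat (n + 1) (n + 1) (\<lambda>(i, j).
     if i = 0 then of_real (q ^ (j * (j - 1) div 2)) * z ^ j
     else of_real (qbinom q j (i - 1) * (1 / 2 ^ (j + 1 - i)) * qpoch_ratio q \<alpha> (j + 1 - i)))"

end

theory Submission
  imports Defs "HOL-Analysis.FPS_Convergence"
begin

text \<open>With \<open>a = q powr (2 * \<alpha> + 1)\<close> and \<open>c m = (a; q\<^sup>2)\<^sub>m / (2 ^ m (a; q)\<^sub>m)\<close>, the series \<open>C(t) = \<Sum> c m t ^ m / [m]!\<close> satisfies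
  \<open>g2(i t) = E_q(- t / 2) C(t)\<close>, because both sides solve the same second-order \<open>q\<close>-difference
  equation. The generating function therefore turns into \<open>(\<Sum> B n t ^ n / [n]!) C(t) = E_q(z t)\<close>. Comparing
  coefficients gives a unitriangular linear system for the \<open>B n\<close>, and the determinant is its solution
  by Cramer's rule.\<close>

section \<open>\<open>q\<close>-Pochhammer symbols\<close>

lemma qpoch_0 [simp]: "qpoch a q 0 = 1"
  by (simp add: qpoch_def)

lemma qpoch_Suc [simp]: "qpoch a q (Suc n) = qpoch a q n * (1 - a * q ^ n)"
  by (simp add: qpoch_def)

lemma qpoch_Suc': "qpoch a q (Suc n) = (1 - a) * qpoch (a * q) q n"
  unfolding qpoch_def by (subst prod.lessThan_Suc_shift) (simp add: mult.assoc)

lemma qpoch_nonzero: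
  fixes a q :: "'a :: idom"
  assumes "\<And>k. k < n \<Longrightarrow> a * q ^ k \<noteq> 1"
  shows "qpoch a q n \<noteq> 0"
  using assms unfolding qpoch_def by auto

lemma triangle_Suc: "Suc n * (Suc n - 1) div 2 = n + n * (n - 1) div (2 :: nat)"
proof (cases n)
  case (Suc m)
  have "Suc (Suc m) * Suc m = Suc m * m + Suc m * 2"
    by (simp add: algebra_simps)
  then have "Suc (Suc m) * Suc m div 2 = (Suc m * m + Suc m * 2) div 2"
    by presburger
  also have "\<dots> = Suc m + Suc m * m div 2"
    by simp
  finally show ?thesis
    using Suc by simp
qed simp

lemma qfact_eq:
  assumes "q \<noteq> 1"
  shows "qfact q n = qpoch q q n / (1 - q) ^ n"
proof (induction n)
  case (Suc n)
  have "qfact q (Suc n) = qfact q n * qnum q (Suc n)"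
    by (simp add: qfact_def)
  then show ?case
    using Suc by (simp add: qnum_def)
qed (simp add: qfact_def)

section \<open>The formal product identity\<close>

text \<open>By Euler's expansion these are, for |q| < 1, the coefficients of the infinite product
  \<open>(s X; q)\<close> in \<open>X\<close>. With \<open>s = (1 - q) / 2\<close> the series is
  \<open>E_q(- X / 2)\<close>.\<close>

definition qexp_coeff :: "'a :: field \<Rightarrow> 'a \<Rightarrow> nat \<Rightarrow> 'a" where
  "qexp_coeff q s n = q ^ (n * (n - 1) div 2) * (- s) ^ n / qpoch q q n"

text \<open>The product starts at \<open>k = 1\<close>: the \<open>k = 0\<close> factor
  \<open>1 - a\<close> is already cancelled, so \<open>a = 1\<close>, that is \<alpha> = -1/2, needs
  no separate treatment.\<close>

definition ratio_coeff :: "'a :: field \<Rightarrow> 'a \<Rightarrow> 'a \<Rightarrow> nat \<Rightarrow> 'a" where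
  "ratio_coeff a q s n = (\<Prod>k=1..<n. (1 - a * q ^ (2 * k)) / (1 - a * q ^ k)) * s ^ n / qpoch q q n"

definition bessel_coeff :: "'a :: field \<Rightarrow> 'a \<Rightarrow> 'a \<Rightarrow> nat \<Rightarrow> 'a" where
  "bessel_coeff a q s n = a ^ n * q ^ (n * (2 * n - 1)) * s ^ (2 * n)
     / (qpoch (q\<^sup>2) (q\<^sup>2) n * qpoch (a * q) (q\<^sup>2) n)"

context
  fixes a q s :: "'a :: field"
  assumes q: "\<And>n. n > 0 \<Longrightarrow> q ^ n \<noteq> 1" and a: "\<And>n. n > 0 \<Longrightarrow> a * q ^ n \<noteq> 1" and q0: "q \<noteq> 0"
begin

lemma qpoch_q_nonzero: "qpoch q q n \<noteq> 0"
  using q[of "Suc _"] by (intro qpoch_nonzero) simp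

lemma qexp_coeff_Suc: "qexp_coeff q s (Suc n) * (1 - q ^ Suc n) = - s * q ^ n * qexp_coeff q s n"
proof -
  have "1 - q ^ Suc n \<noteq> 0"
    using q[of "Suc n"] by simp
  then show ?thesis
    using qpoch_q_nonzero[of n] unfolding qexp_coeff_def triangle_Suc
    by (simp add: field_simps power_add)
qed

lemma ratio_coeff_Suc:
  "ratio_coeff a q s (Suc n) * ((1 - a * q ^ n) * (1 - q ^ Suc n))
     = s * (1 - a * q ^ (2 * n)) * ratio_coeff a q s n"
proof -
  have *: "1 - q ^ Suc n \<noteq> 0"
    using q[of "Suc n"] by simp
  show ?thesis
  \<comment> \<open>At \<open>n = 0\<close> the product stays empty and both sides carry the factor
    \<open>1 - a\<close>, which may be zero and must not be divided by.\<close>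
  proof (cases "n = 0")
    case False
    have 1: "1 - a * q ^ n \<noteq> 0"
      using a[of n] False by simp
    define P where "P = (\<Prod>k=1..<n. (1 - a * q ^ (2 * k)) / (1 - a * q ^ k))"
    have P: "(\<Prod>k=1..<Suc n. (1 - a * q ^ (2 * k)) / (1 - a * q ^ k))
               = P * ((1 - a * q ^ (2 * n)) / (1 - a * q ^ n))"
      using False by (simp add: P_def)
    show ?thesis
      unfolding ratio_coeff_def P P_def[symmetric] qpoch_Suc power_Suc[symmetric]
      using * 1 qpoch_q_nonzero[of n] by (simp add: divide_simps)
  qed (use * in \<open>simp add: ratio_coeff_def\<close>)
qed

lemma bessel_coeff_Suc:
  "bessel_coeff a q s (Suc n) * ((1 - q ^ (2 * n + 2)) * (1 - a * q ^ (2 * n + 1)))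
     = a * q ^ (4 * n + 1) * s\<^sup>2 * bessel_coeff a q s n"
proof -
  have q2: "1 - q ^ (2 * k + 2) \<noteq> 0" and a2: "1 - a * q ^ (2 * k + 1) \<noteq> 0" for k
    using q[of "2 * k + 2"] a[of "2 * k + 1"] by simp_all
  have nz: "qpoch (q\<^sup>2) (q\<^sup>2) n \<noteq> 0" "qpoch (a * q) (q\<^sup>2) n \<noteq> 0"
    using q2 a2 by (auto intro!: qpoch_nonzero simp: power_mult[symmetric] power_add[symmetric] mult.assoc)
  have poch: "qpoch (q\<^sup>2) (q\<^sup>2) (Suc n) = qpoch (q\<^sup>2) (q\<^sup>2) n * (1 - q ^ (2 * n + 2))"
    "qpoch (a * q) (q\<^sup>2) (Suc n) = qpoch (a * q) (q\<^sup>2) n * (1 - a * q ^ (2 * n + 1))"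
    by (simp_all add: power_mult[symmetric] power_add[symmetric] mult.assoc)
  have "Suc n * (2 * Suc n - 1) = (4 * n + 1) + n * (2 * n - 1)"
    by (cases n) (auto simp: algebra_simps)
  then have pow: "q ^ (Suc n * (2 * Suc n - 1)) = q ^ (4 * n + 1) * q ^ (n * (2 * n - 1))"
    "s ^ (2 * Suc n) = s\<^sup>2 * s ^ (2 * n)"
    by (simp_all only: power_add) (simp add: power2_eq_square)
  show ?thesis
    using q2[of n] a2[of n] nz unfolding bessel_coeff_def poch pow power_Suc
    by (simp add: divide_simps del: power_Suc power_add)
qed

text \<open>Write \<open>T\<close> for the substitution \<open>X \<mapsto> q X\<close>. The product \<open>H\<close> of the two series on the left
  satisfies \<open>q H - (q + a) T H + a (1 - (q s X)\<^sup>2) T\<^sup>2 H = 0\<close>. This determines the coefficients of \<open>H\<close>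
  of index at least \<open>2\<close> from the first two. For \<open>a = 1\<close> it says nothing about the coefficient
  of index \<open>1\<close>, which is therefore computed directly.\<close>

lemma qexp_times_ratio:
  "Abs_fps (qexp_coeff q s) * Abs_fps (ratio_coeff a q s)
     = Abs_fps (\<lambda>n. if even n then bessel_coeff a q s (n div 2) else 0)"
proof -
  \<comment> \<open>As a composition, \<open>T\<close> is multiplicative.\<close>
  define T :: "'a fps \<Rightarrow> 'a fps" where "T F = fps_compose F (fps_const q * fps_X)" for F
  have T_nth [simp]: "fps_nth (T F) n = q ^ n * fps_nth F n" for F n
    by (simp add: T_def)
  have T_mult: "T (F * G) = T F * T G" for F G
    by (simp add: T_def fps_compose_mult_distrib)
  define E where "E = Abs_fps (qexp_coeff q s)"
  define F where "F = Abs_fps (ratio_coeff a q s)"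
  define H where "H = E * F"
  have coeff_const: "fps_nth (fps_const c * G) n = c * fps_nth G n" for c :: 'a and G n
    by simp
  have coeff_X: "fps_nth (fps_X * G) (Suc n) = fps_nth G n" "fps_nth (fps_X * G) 0 = 0"
    for G :: "'a fps" and n by simp_all

  \<comment> \<open>The product \<open>(s X; q)\<close> loses its first factor
    \<open>1 - s X\<close> when \<open>X\<close> becomes \<open>q X\<close>.\<close>
  have E: "E = T E - fps_const s * (fps_X * T E)"
  proof (rule fps_ext)
    fix n show "fps_nth E n = fps_nth (T E - fps_const s * (fps_X * T E)) n"
    proof (cases n)
      case (Suc m)
      show ?thesis
        using qexp_coeff_Suc[of m] unfolding Suc fps_sub_nth coeff_const coeff_X T_nth
        by (simp add: E_def algebra_simps)
    qed (simp add: E_def)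
  qed
  have TE: "T E = T (T E) - fps_const (q * s) * (fps_X * T (T E))"
  proof (rule fps_ext)
    fix n show "fps_nth (T E) n = fps_nth (T (T E) - fps_const (q * s) * (fps_X * T (T E))) n"
    proof (cases n)
      case (Suc m)
      show ?thesis
        using arg_cong[OF qexp_coeff_Suc[of m], of "\<lambda>x. q ^ Suc m * x"]
        unfolding Suc fps_sub_nth coeff_const coeff_X T_nth
        by (simp add: E_def algebra_simps)
    qed (simp add: E_def)
  qed
  \<comment> \<open>This is \<open>ratio_coeff_Suc\<close> times \<open>q\<close>: each power
    \<open>q ^ n\<close> becomes one application of \<open>T\<close>, and
    \<open>q - (q + a) x + a x\<^sup>2 = (1 - x) (q - a x)\<close> with
    \<open>x = q ^ (m + 1)\<close>.\<close>
  have F: "fps_const q * F - fps_const (q * s) * (fps_X * F) - fps_const (q + a) * T F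
     + fps_const a * T (T F) + fps_const (a * q * s) * (fps_X * T (T F)) = 0"
  proof (rule fps_ext)
    fix n show "fps_nth (fps_const q * F - fps_const (q * s) * (fps_X * F) - fps_const (q + a) * T F
     + fps_const a * T (T F) + fps_const (a * q * s) * (fps_X * T (T F))) n = fps_nth 0 n"
    proof (cases n)
      case (Suc m)
      show ?thesis
        using arg_cong[OF ratio_coeff_Suc[of m], of "\<lambda>x. q * x"]
        unfolding Suc fps_sub_nth fps_add_nth coeff_const coeff_X T_nth
        by (simp add: F_def algebra_simps mult_2_right power_add)
    qed (simp add: F_def algebra_simps)
  qed
  \<comment> \<open>Both \<open>H\<close> and \<open>T H\<close> contain the factor
    \<open>T E = (1 - q s X) T\<^sup>2 E\<close>. In the last term it comes from
    \<open>1 - (q s X)\<^sup>2 = (1 - q s X) (1 + q s X)\<close>. Pulling it out leaves the equation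
    for \<open>F\<close>.\<close>
  have "fps_const q * H - fps_const (q + a) * T H + fps_const a * T (T H)
          - fps_const (a * q\<^sup>2 * s\<^sup>2) * (fps_X * (fps_X * T (T H)))
     = (T (T E) - fps_const (q * s) * (fps_X * T (T E)))
       * (fps_const q * F - fps_const (q * s) * (fps_X * F) - fps_const (q + a) * T F
     + fps_const a * T (T F) + fps_const (a * q * s) * (fps_X * T (T F)))"
  proof -
    define E' F' F'' Q A S where "E' = T (T E)" and "F' = T F" and "F'' = T (T F)"
      and "Q = fps_const q" and "A = fps_const a" and "S = fps_const s"
    have 1: "T E = (1 - Q * S * fps_X) * E'"
      using TE by (simp add: E'_def Q_def S_def algebra_simps flip: fps_const_mult)
    have 2: "E = (1 - S * fps_X) * T E"
      using E by (simp add: S_def algebra_simps)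
    have 3: "fps_const (q + a) = Q + A" "fps_const (q * s) = Q * S"
      "fps_const (a * q * s) = A * Q * S" "fps_const (a * q\<^sup>2 * s\<^sup>2) = A * Q * Q * S * S"
      by (simp_all add: Q_def A_def S_def power2_eq_square mult_ac)
    have H: "H = (1 - S * fps_X) * ((1 - Q * S * fps_X) * E') * F"
      unfolding H_def by (subst 2, subst 1) (rule refl)
    have TH: "T H = (1 - Q * S * fps_X) * E' * F'"
      unfolding H_def T_mult by (simp only: 1 F'_def)
    have TTH: "T (T H) = E' * F''"
      by (simp only: H_def T_mult E'_def F''_def)
    have TTE: "T (T E) - fps_const (q * s) * (fps_X * T (T E)) = (1 - Q * S * fps_X) * E'"
      by (simp add: E'_def 3 algebra_simps)
    show ?thesis
      unfolding TTH TTE F''_def[symmetric] unfolding TH F'_def[symmetric] unfolding H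
      unfolding 3 Q_def[symmetric] A_def[symmetric]
      by (simp add: algebra_simps)
  qed
  then have ode: "fps_const q * H - fps_const (q + a) * T H + fps_const a * T (T H)
          - fps_const (a * q\<^sup>2 * s\<^sup>2) * (fps_X * (fps_X * T (T H))) = 0"
    unfolding F by simp
  \<comment> \<open>At index \<open>n + 2\<close> the same quadratic in
    \<open>x = q ^ (n + 2)\<close> yields \<open>1 - a * q ^ (n + 1)\<close>, nonzero even for
    \<open>a = 1\<close>; at index 1 it would yield \<open>1 - a\<close>.\<close>
  have rec: "fps_nth H (n + 2) * ((1 - q ^ (n + 2)) * (1 - a * q ^ (n + 1)))
               = a * q ^ (2 * n + 1) * s\<^sup>2 * fps_nth H n" for n
  proof -
    have "fps_nth (fps_const q * H - fps_const (q + a) * T H + fps_const a * T (T H)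
          - fps_const (a * q\<^sup>2 * s\<^sup>2) * (fps_X * (fps_X * T (T H)))) (Suc (Suc n)) = 0"
      unfolding ode by simp
    then have "q * (fps_nth H (n + 2) * ((1 - q ^ (n + 2)) * (1 - a * q ^ (n + 1))))
               = q * (a * q ^ (2 * n + 1) * s\<^sup>2 * fps_nth H n)"
      unfolding fps_sub_nth fps_add_nth coeff_const coeff_X T_nth
      by (simp add: algebra_simps mult_2_right power_add power2_eq_square)
    then show ?thesis
      using q0 by simp
  qed
  have nz: "(1 - q ^ (n + 2)) * (1 - a * q ^ (n + 1)) \<noteq> 0" for n
    using q[of "n + 2"] a[of "n + 1"] by simp
  have even: "fps_nth H (2 * n) = bessel_coeff a q s n" for n
  proof (induction n)
    case 0
    show ?case
      by (simp add: H_def E_def F_def qexp_coeff_def ratio_coeff_def bessel_coeff_def)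
  next
    case (Suc n)
    have "fps_nth H (2 * n + 2) * ((1 - q ^ (2 * n + 2)) * (1 - a * q ^ (2 * n + 1)))
       = bessel_coeff a q s (Suc n) * ((1 - q ^ (2 * n + 2)) * (1 - a * q ^ (2 * n + 1)))"
      using bessel_coeff_Suc[of n] rec[of "2 * n"] Suc by simp
    then have "fps_nth H (2 * n + 2) = bessel_coeff a q s (Suc n)"
      using nz[of "2 * n"] mult_right_cancel by blast
    then show ?case
      by simp
  qed
  \<comment> \<open>The coefficient of index 1 is
    \<open>- s / (1 - q) + s / (1 - q)\<close>.\<close>
  have odd: "fps_nth H (2 * n + 1) = 0" for n
  proof (induction n)
    case 0
    show ?case
      using q[of 1]
      by (simp add: H_def E_def F_def fps_mult_nth qexp_coeff_def ratio_coeff_def)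
  next
    case (Suc n)
    have "fps_nth H (2 * n + 1 + 2) = 0"
      using rec[of "2 * n + 1"] nz[of "2 * n + 1"] unfolding Suc by (metis mult_eq_0_iff mult_zero_right)
    then show ?case
      by (simp add: algebra_simps)
  qed
  show ?thesis
  proof (rule fps_ext)
    fix n
    show "fps_nth (Abs_fps (qexp_coeff q s) * Abs_fps (ratio_coeff a q s)) n =
      fps_nth (Abs_fps (\<lambda>n. if even n then bessel_coeff a q s (n div 2) else 0)) n"
      using even[of "n div 2"] odd[of "n div 2"]
      unfolding H_def E_def F_def by (cases "even n") auto
  qed
qed

end

section \<open>A determinant read off a unitriangular recursion\<close>

text \<open>Subtracting \<open>b i\<close> times row \<open>i + 1\<close> from row \<open>0\<close> for all \<open>i < n\<close> leaves \<open>(0, \<dots>, 0, b n)\<close> there,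
  and the minor of this last entry is unitriangular.\<close>

lemma det_unitriangular_recursion:
  fixes b y :: "nat \<Rightarrow> 'a :: comm_ring_1"
  assumes diag: "\<And>k. t k k = 1" and low: "\<And>k j. j < k \<Longrightarrow> t k j = 0"
    and y: "\<And>j. y j = (\<Sum>k\<le>j. b k * t k j)"
  shows "Determinant.det (Matrix.mat (n + 1) (n + 1) (\<lambda>(i, j). if i = 0 then y j else t (i - 1) j))
           = (-1) ^ n * b n"
    (is "Determinant.det ?M = _")
proof -
  \<comment> \<open>Left multiplication by \<open>L\<close> performs these row operations; the index
    shift in \<open>b (j - 1)\<close> reflects that row \<open>k + 1\<close> holds
    \<open>t k\<close>.\<close>
  define L where "L = Matrix.mat (n + 1) (n + 1)
    (\<lambda>(i, j). if i = j then 1 else if i = 0 then - b (j - 1) else 0)"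
  define N where "N = Matrix.mat (n + 1) (n + 1)
    (\<lambda>(i, j). if i = 0 then if j = n then b n else 0 else t (i - 1) j)"
  have carrier: "L \<in> carrier_mat (n + 1) (n + 1)" "?M \<in> carrier_mat (n + 1) (n + 1)"
      "N \<in> carrier_mat (n + 1) (n + 1)"
    by (simp_all add: L_def N_def)
  have detL: "Determinant.det L = 1"
  proof (subst det_upper_triangular[OF _ carrier(1)])
    show "upper_triangular L"
      by (auto simp: L_def)
    show "prod_list (diag_mat L) = 1"
      unfolding prod_list_diag_prod by (auto simp: L_def intro!: prod.neutral)
  qed
  have "L * ?M = N"
  proof (rule eq_matI)
    fix i j assume "i < dim_row N" "j < dim_col N"
    then have ij: "i < n + 1" "j < n + 1"
      by (simp_all add: N_def)
    have "(L * ?M) $$ (i, j) = (\<Sum>k<n+1. L $$ (i, k) * ?M $$ (k, j))"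
      using ij by (simp add: L_def scalar_prod_def atLeast0LessThan del: sum.lessThan_Suc)
    also have "\<dots> = L $$ (i, 0) * y j + (\<Sum>k<n. L $$ (i, Suc k) * t k j)"
      using ij by (simp add: sum.lessThan_Suc_shift del: sum.lessThan_Suc)
    also have "\<dots> = N $$ (i, j)"
    proof (cases i)
      case 0
      have "(\<Sum>k\<le>j. b k * t k j) = (\<Sum>k\<le>n. b k * t k j)"
        using ij low by (intro sum.mono_neutral_left) auto
      \<comment> \<open>The rows of the matrix reach only \<open>t (n - 1)\<close>, so the summand
        \<open>k = n\<close> is not eliminated. It survives in column \<open>n\<close> alone, with
        value \<open>b n\<close>.\<close>
      also have "\<dots> = (\<Sum>k<n. b k * t k j) + b n * t n j"
        by (simp add: lessThan_Suc_atMost[symmetric])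
      finally have "y j = (\<Sum>k<n. b k * t k j) + (if j = n then b n else 0)"
        using y[of j] ij low[of j n] diag[of n] by auto
      then show ?thesis
        using 0 ij by (simp add: L_def N_def sum_negf)
    next
      case (Suc m)
      have "(\<Sum>k<n. L $$ (i, Suc k) * t k j) = (\<Sum>k<n. if k = m then t k j else 0)"
        using Suc ij by (intro sum.cong) (auto simp: L_def)
      also have "\<dots> = t m j"
        using Suc ij by simp
      finally show ?thesis
        using Suc ij by (simp add: L_def N_def)
    qed
    finally show "(L * ?M) $$ (i, j) = N $$ (i, j)" .
  qed (simp_all add: L_def N_def)
  then have "Determinant.det ?M = Determinant.det N"
    using det_mult[OF carrier(1,2)] detL by simp
  also have "\<dots> = (\<Sum>j<n+1. N $$ (0, j) * cofactor N 0 j)"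
    by (rule laplace_expansion_row[OF carrier(3)]) simp
  also have "\<dots> = b n * cofactor N 0 n"
    by (simp add: N_def)
  also have "Determinant.det (mat_delete N 0 n) = 1"
  proof -
    have D: "mat_delete N 0 n = Matrix.mat n n (\<lambda>(i, j). t i j)"
      by (rule eq_matI) (auto simp: mat_delete_def N_def)
    show ?thesis
      unfolding D
    proof (subst det_upper_triangular[of _ n])
      show "upper_triangular (Matrix.mat n n (\<lambda>(i, j). t i j))"
        using low by auto
      show "prod_list (diag_mat (Matrix.mat n n (\<lambda>(i, j). t i j))) = 1"
        unfolding prod_list_diag_prod using diag by (auto intro!: prod.neutral)
    qed simp
  qed
  then have "b n * cofactor N 0 n = (-1) ^ n * b n"
    by (simp add: cofactor_def)
  finally show ?thesis .
qed

section \<open>Convergence\<close>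

lemma fps_conv_radius_pos_if_geometric:
  fixes F :: "'a :: {banach, real_normed_div_algebra} fps"
  assumes "\<And>n. norm (fps_nth F n) \<le> C * K ^ n"
  shows "fps_conv_radius F > 0"
proof -
  \<comment> \<open>The radius gives \<open>\<bar>K\<bar> * norm z \<le> 1 / 2\<close>; adding 1
    also covers \<open>K = 0\<close>.\<close>
  define z :: 'a where "z = of_real (1 / (2 * (\<bar>K\<bar> + 1)))"
  have norm_z: "norm z = 1 / (2 * (\<bar>K\<bar> + 1))"
    unfolding z_def norm_of_real by simp
  have Kz: "\<bar>K\<bar> * norm z \<le> 1 / 2"
    unfolding norm_z by (simp add: divide_simps)
  have "summable (\<lambda>n. fps_nth F n * z ^ n)"
  proof (rule summable_comparison_test')
    show "summable (\<lambda>n. \<bar>C\<bar> * (1 / 2) ^ n :: real)"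
      by (intro summable_mult summable_geometric) simp
    fix n
    have "norm (fps_nth F n * z ^ n) \<le> C * K ^ n * norm z ^ n"
      using assms[of n] by (simp add: norm_mult norm_power mult_right_mono)
    also have "\<dots> \<le> \<bar>C\<bar> * \<bar>K\<bar> ^ n * norm z ^ n"
      by (intro mult_right_mono) (auto simp flip: power_abs abs_mult)
    also have "\<dots> = \<bar>C\<bar> * (\<bar>K\<bar> * norm z) ^ n"
      by (simp add: power_mult_distrib)
    also have "\<dots> \<le> \<bar>C\<bar> * (1 / 2) ^ n"
      using Kz by (intro mult_left_mono power_mono) auto
    finally show "norm (fps_nth F n * z ^ n) \<le> \<bar>C\<bar> * (1 / 2) ^ n" .
  qed
  then have "fps_conv_radius F \<ge> norm z"
    unfolding fps_conv_radius_def by (rule conv_radius_geI)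
  moreover have "ereal (norm z) > 0"
    unfolding norm_z by simp
  ultimately show ?thesis
    by order
qed

lemma has_fps_expansionI_eval:
  assumes "fps_conv_radius F > 0" "\<And>t. eval_fps F t = f t"
  shows "f has_fps_expansion F"
  using assms by (simp add: has_fps_expansion_def)

text \<open>Translates the condition in the definition of \<open>qBernoulli2\<close> into one that
  is closed under products and inverses and determines the series.\<close>

lemma has_fps_expansion_iff_sums:
  fixes F :: "complex fps"
  shows "f has_fps_expansion F \<longleftrightarrow>
    (\<exists>r>0. \<forall>t. norm t < r \<longrightarrow> (\<lambda>n. fps_nth F n * t ^ n) sums f t)"
proof
  assume *: "f has_fps_expansion F"
  then obtain r where r: "r > 0" "\<And>t. norm t < r \<Longrightarrow> eval_fps F t = f t"
    by (auto simp: has_fps_expansion_def eventually_nhds_metric)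
  from * have "0 < fps_conv_radius F"
    by (simp add: has_fps_expansion_def)
  \<comment> \<open>A real radius is interposed because the radius of convergence may be
    infinite.\<close>
  then obtain r' where r': "0 < ereal r'" "ereal r' < fps_conv_radius F"
    using ereal_dense2 by blast
  have "(\<lambda>n. fps_nth F n * t ^ n) sums f t" if "norm t < min r r'" for t
  proof -
    have "ereal (norm t) < fps_conv_radius F"
      using that r'(2) by (metis ereal_less_le less_eq_ereal_def min_less_iff_conj order_less_imp_le less_ereal.simps(1) order_less_trans)
    from sums_eval_fps[OF this] show ?thesis
      using r(2) that by simp
  qed
  then show "\<exists>r>0. \<forall>t. norm t < r \<longrightarrow> (\<lambda>n. fps_nth F n * t ^ n) sums f t"
    using r(1) r'(1) by (intro exI[of _ "min r r'"]) auto
next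
  assume "\<exists>r>0. \<forall>t. norm t < r \<longrightarrow> (\<lambda>n. fps_nth F n * t ^ n) sums f t"
  then obtain r where r: "r > 0" "\<And>t. norm t < r \<Longrightarrow> (\<lambda>n. fps_nth F n * t ^ n) sums f t"
    by blast
  have "summable (\<lambda>n. fps_nth F n * complex_of_real (r / 2) ^ n)"
    using r(2)[of "complex_of_real (r / 2)"] r(1) by (auto simp: sums_iff)
  then have "fps_conv_radius F \<ge> norm (complex_of_real (r / 2))"
    unfolding fps_conv_radius_def by (rule conv_radius_geI)
  moreover have "ereal (norm (complex_of_real (r / 2))) > 0"
    using r(1) by simp
  ultimately have "fps_conv_radius F > 0"
    by order
  moreover have "eventually (\<lambda>t. eval_fps F t = f t) (nhds 0)"
    unfolding eventually_nhds_metric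
    using r by (intro exI[of _ r]) (auto simp: eval_fps_def sums_iff)
  ultimately show "f has_fps_expansion F"
    by (simp add: has_fps_expansion_def)
qed

lemma has_fps_expansion_unique:
  fixes F G :: "complex fps"
  assumes "f has_fps_expansion F" "f has_fps_expansion G"
  shows "F = G"
proof (rule eval_fps_eqD)
  show "eventually (\<lambda>z. eval_fps F z = eval_fps G z) (nhds 0)"
    using assms unfolding has_fps_expansion_def by (auto elim: eventually_elim2)
qed (use assms in \<open>simp_all add: has_fps_expansion_def\<close>)

section \<open>The generating function\<close>

lemma qfact_ge_1:
  assumes "0 < q" "q < 1"
  shows "qfact q n \<ge> 1"
proof -
  have "qnum q k \<ge> 1" if "k \<ge> 1" for k
  proof -
    have "q ^ k \<le> q ^ 1"
      using assms that by (intro power_decreasing) auto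
    then show ?thesis
      using assms by (simp add: qnum_def)
  qed
  then show ?thesis
    unfolding qfact_def by (intro prod_ge_1) auto
qed

lemma qbinom_eq_qfact:
  assumes "0 < q" "q < 1" "k \<le> n"
  shows "qbinom q n k = qfact q n / (qfact q k * qfact q (n - k))"
proof -
  have "(1 - q) ^ n = (1 - q) ^ k * (1 - q) ^ (n - k)"
    using assms by (simp flip: power_add)
  then show ?thesis
    using assms by (simp add: qbinom_def qfact_eq)
qed

definition E_q_fps :: "real \<Rightarrow> complex \<Rightarrow> complex fps" where
  "E_q_fps q w = Abs_fps (\<lambda>n. of_real (q ^ (n * (n - 1) div 2) / qfact q n) * w ^ n)"

lemma E_q_has_fps_expansion:
  assumes "0 < q" "q < 1"
  shows "(\<lambda>t. E_q q (w * t)) has_fps_expansion E_q_fps q w"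
proof (rule has_fps_expansionI_eval)
  show "fps_conv_radius (E_q_fps q w) > 0"
  proof (rule fps_conv_radius_pos_if_geometric)
    fix n
    have "q ^ (n * (n - 1) div 2) / qfact q n \<le> 1"
      using qfact_ge_1[OF assms, of n] power_le_one[of q "n * (n - 1) div 2"] assms by simp
    then have "norm (complex_of_real (q ^ (n * (n - 1) div 2) / qfact q n)) \<le> 1"
      using qfact_ge_1[OF assms, of n] assms unfolding norm_of_real by simp
    then show "norm (fps_nth (E_q_fps q w) n) \<le> 1 * norm w ^ n"
      unfolding E_q_fps_def fps_nth_Abs_fps norm_mult norm_power by (rule mult_right_mono) simp
  qed
  show "eval_fps (E_q_fps q w) t = E_q q (w * t)" for t
    by (simp add: eval_fps_def E_q_fps_def E_q_def power_mult_distrib mult.assoc)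
qed

section \<open>Expansion of \<open>g2(i t)\<close> for fixed q and \<alpha>\<close>

context
  fixes q \<alpha> a s :: real
  assumes q: "0 < q" "q < 1" and \<alpha>: "\<alpha> > -1"
  defines "a \<equiv> q powr (2 * \<alpha> + 1)" and "s \<equiv> (1 - q) / 2"
begin

lemma power_q_neq_1: "n > 0 \<Longrightarrow> q ^ n \<noteq> 1"
  using q power_strict_decreasing[of 0 n q] by auto

lemma a_q: "a * q = q powr (2 * \<alpha> + 2)"
proof -
  have "q powr (2 * \<alpha> + 1) * q powr 1 = q powr (2 * \<alpha> + 2)"
    by (subst powr_add[symmetric]) (simp add: algebra_simps)
  then show ?thesis
    using q by (simp add: a_def)
qed

text \<open>Here \<alpha> > -1 enters as \<open>2 * \<alpha> + 2 > 0\<close>. The number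
  \<open>a\<close> itself is at least 1 when \<alpha> \<le> -1/2, so later bounds rely on
  \<open>a * q\<close>.\<close>

lemma a_pos: "a > 0" and a_q_less_1: "a * q < 1"
  using q \<alpha> powr_less_mono'[of q 0 "2 * \<alpha> + 2"] unfolding a_q by (auto simp: a_def)

lemma a_power_q_le: "n > 0 \<Longrightarrow> a * q ^ n \<le> a * q"
  using q a_pos power_decreasing[of 1 n q] by simp

lemma a_power_q_neq_1: "n > 0 \<Longrightarrow> a * q ^ n \<noteq> 1"
  using a_power_q_le[of n] a_q_less_1 by simp

text \<open>\<open>K\<close> bounds the quotient of consecutive coefficients: the numerator is
  largest and the denominator bound smallest with \<open>q ^ (4 * n + 1)\<close> replaced by
  \<open>q\<close> and both denominator factors by \<open>1 - q\<close> and
  \<open>1 - a * q\<close>. This crude bound suffices for a positive radius.\<close>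

lemma bessel_coeff_bounds:
  defines "K \<equiv> a * q * s\<^sup>2 / ((1 - q) * (1 - a * q))"
  shows "0 \<le> bessel_coeff a q s n \<and> bessel_coeff a q s n \<le> K ^ n"
proof (induction n)
  case (Suc n)
  define D where "D = (1 - q ^ (2 * n + 2)) * (1 - a * q ^ (2 * n + 1))"
  define d where "d = (1 - q) * (1 - a * q)"
  have d: "d > 0"
    using q a_q_less_1 by (simp add: d_def)
  have "q ^ (2 * n + 2) \<le> q ^ 1"
    using q by (intro power_decreasing) auto
  then have D: "d \<le> D"
    unfolding d_def D_def
    using q a_q_less_1 a_power_q_le[of "2 * n + 1"] power_le_one[of q "2 * n + 2"]
    by (intro mult_mono) auto
  define R where "R = a * q ^ (4 * n + 1) * s\<^sup>2 * bessel_coeff a q s n"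
  have "q ^ (4 * n + 1) \<le> q ^ 1"
    using q by (intro power_decreasing) auto
  then have "R \<le> a * q * s\<^sup>2 * K ^ n"
    unfolding R_def using Suc a_pos q by (intro mult_mono) auto
  also have "\<dots> = K ^ Suc n * d"
    using d by (simp add: K_def flip: d_def)
  finally have R: "R \<le> K ^ Suc n * d" .
  have R0: "0 \<le> R"
    unfolding R_def using Suc a_pos q by (intro mult_nonneg_nonneg) auto
  have "bessel_coeff a q s (Suc n) * D = R"
    unfolding D_def R_def
    by (rule bessel_coeff_Suc[OF power_q_neq_1 a_power_q_neq_1]) (use q in auto)
  then have eq: "bessel_coeff a q s (Suc n) = R / D"
    using d D by (simp add: field_simps)
  have "R / D \<le> R / d"
    using R0 d D by (intro divide_left_mono) auto
  also have "\<dots> \<le> K ^ Suc n"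
    using R d by (simp add: pos_divide_le_eq)
  finally show ?case
    unfolding eq using R0 d D by simp
qed (simp add: bessel_coeff_def)

lemma bessel_coeff_eq:
  "bessel_coeff a q s n = q powr (2 * real n * (real n + \<alpha>)) * ((1 - q) / 2) ^ (2 * n)
     / (qpoch (q\<^sup>2) (q\<^sup>2) n * qpoch (q powr (2 * \<alpha> + 2)) (q\<^sup>2) n)"
proof -
  have "a ^ n * q ^ (n * (2 * n - 1)) = q powr (2 * real n * (real n + \<alpha>))"
  proof (cases "n = 0")
    case False
    have "a ^ n * q ^ (n * (2 * n - 1))
            = q powr ((2 * \<alpha> + 1) * real n) * q powr real (n * (2 * n - 1))"
      using q by (simp only: a_def powr_powr[symmetric] powr_realpow powr_gt_zero)
    also have "\<dots> = q powr ((2 * \<alpha> + 1) * real n + real (n * (2 * n - 1)))"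
      by (simp add: powr_add)
    also have "(2 * \<alpha> + 1) * real n + real (n * (2 * n - 1)) = 2 * real n * (real n + \<alpha>)"
      using False by (simp add: of_nat_diff algebra_simps)
    finally show ?thesis .
  qed (use q in auto)
  then show ?thesis
    unfolding bessel_coeff_def a_q by (simp add: s_def)
qed

text \<open>At the argument \<open>i t\<close> the sign \<open>(-1) ^ n\<close> cancels against
  \<open>i ^ (2 * n)\<close>, leaving nonnegative coefficients.\<close>

definition g2_fps :: "complex fps" where
  "g2_fps = Abs_fps (\<lambda>n. of_real (if even n then bessel_coeff a q s (n div 2) else 0))"

lemma g2_has_fps_expansion: "(\<lambda>t. g2 q \<alpha> (\<i> * t)) has_fps_expansion g2_fps"
proof (rule has_fps_expansionI_eval)
  define K where "K = a * q * s\<^sup>2 / ((1 - q) * (1 - a * q))"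
  have K: "K \<ge> 0"
    unfolding K_def using a_pos q a_q_less_1 by simp
  show "fps_conv_radius g2_fps > 0"
  proof (rule fps_conv_radius_pos_if_geometric)
    fix n
    \<comment> \<open>The base \<open>1 + K\<close> is at least 1, so the exponent
      \<open>n div 2\<close> may be raised to \<open>n\<close> even if \<open>K < 1\<close>.\<close>
    show "norm (fps_nth g2_fps n) \<le> 1 * (1 + K) ^ n"
    proof (cases "even n")
      case True
      have "norm (fps_nth g2_fps n) \<le> K ^ (n div 2)"
        using bessel_coeff_bounds[of "n div 2"] True by (simp add: g2_fps_def K_def)
      also have "\<dots> \<le> (1 + K) ^ (n div 2)"
        using K by (intro power_mono) auto
      also have "\<dots> \<le> (1 + K) ^ n"
        using K by (intro power_increasing) auto
      finally show ?thesis
        by simp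
    qed (use K in \<open>simp add: g2_fps_def\<close>)
  qed
  fix t :: complex
  have term_eq: "(-1) ^ n * of_real (q powr (2 * real n * (real n + \<alpha>)))
      * (\<i> * t * (1 - of_real q) / 2) ^ (2 * n)
      / of_real (qpoch (q\<^sup>2) (q\<^sup>2) n * qpoch (q powr (2 * \<alpha> + 2)) (q\<^sup>2) n)
      = fps_nth g2_fps (2 * n) * t ^ (2 * n)" for n
  proof -
    have "(\<i> * t * (1 - of_real q) / 2) ^ (2 * n)
        = (-1) ^ n * (of_real (((1 - q) / 2) ^ (2 * n)) * t ^ (2 * n))"
      by (simp add: power_mult_distrib power_divide power_mult[of \<i>])
    moreover have "(-1) ^ n * (-1) ^ n = (1 :: complex)"
      by (simp flip: power_mult_distrib)
    ultimately show ?thesis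
      by (simp add: g2_fps_def bessel_coeff_eq)
  qed
  \<comment> \<open>The Bessel series lists only the even powers; the odd terms inserted here
    vanish.\<close>
  have "(\<Sum>n. fps_nth g2_fps (2 * n) * t ^ (2 * n)) = (\<Sum>n. fps_nth g2_fps n * t ^ n)"
  proof (rule suminf_mono_reindex)
    fix n :: nat assume "n \<notin> range (\<lambda>n. 2 * n)"
    then have "odd n" by auto
    then show "fps_nth g2_fps n * t ^ n = 0"
      by (simp add: g2_fps_def)
  qed (simp add: strict_mono_def)
  then show "eval_fps g2_fps t = g2 q \<alpha> (\<i> * t)"
    unfolding g2_def term_eq by (simp add: eval_fps_def)
qed

text \<open>For \<alpha> different from -1/2 the common factor \<open>1 - a\<close> is nonzero and
  cancels; at \<alpha> = -1/2 the definition has cancelled it already. Both cases thus share one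
  formula.\<close>

lemma qpoch_ratio_eq: "qpoch_ratio q \<alpha> n = (\<Prod>k=1..<n. (1 - a * q ^ (2 * k)) / (1 - a * q ^ k))"
proof (cases n)
  case 0
  then show ?thesis
    by (simp add: qpoch_ratio_def)
next
  case (Suc m)
  have "a * q\<^sup>2 = q powr (2 * \<alpha> + 1) * q powr 2"
    using q by (simp add: a_def)
  also have "\<dots> = q powr (2 * \<alpha> + 3)"
    by (subst powr_add[symmetric]) (simp add: algebra_simps)
  finally have aq2: "q powr (2 * \<alpha> + 3) = a * q\<^sup>2" ..
  have "qpoch_ratio q \<alpha> n = qpoch (a * q\<^sup>2) (q\<^sup>2) m / qpoch (a * q) q m"
  proof (cases "\<alpha> = - 1 / 2")
    case False
    then have "a \<noteq> 1"
      using q powr_eq_one_iff_gen[of q "2 * \<alpha> + 1"] by (auto simp: a_def)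
    then show ?thesis
      using False by (simp add: qpoch_ratio_def Suc qpoch_Suc' del: qpoch_Suc flip: a_def)
  next
    case True
    then show ?thesis
      unfolding qpoch_ratio_def Suc aq2 a_q by (subst if_P) auto
  qed
  also have "\<dots> = (\<Prod>k<m. (1 - a * q ^ (2 * Suc k)) / (1 - a * q ^ Suc k))"
    unfolding qpoch_def prod_dividef power_mult by (simp add: mult.assoc)
  also have "\<dots> = (\<Prod>k=1..<n. (1 - a * q ^ (2 * k)) / (1 - a * q ^ k))"
    unfolding Suc One_nat_def prod.atLeast_Suc_lessThan_Suc_shift atLeast0LessThan by simp
  finally show ?thesis .
qed

section \<open>The connection series \<open>C\<close> and the recursion for the Bernoulli
  values\<close>

definition connection_fps :: "complex fps" where
  "connection_fps = Abs_fps (\<lambda>n. of_real (qpoch_ratio q \<alpha> n / 2 ^ n / qfact q n))"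

text \<open>The real identity \<open>qexp_times_ratio\<close> at \<open>s = (1 - q) / 2\<close>,
  read over the complex numbers. The powers of \<open>1 - q\<close> turn \<open>qpoch q q n\<close>
  into \<open>qfact q n\<close>.\<close>

lemma g2_fps_eq: "g2_fps = E_q_fps q (-1 / 2) * connection_fps"
proof (rule fps_ext)
  fix n
  have "of_real (fps_nth (Abs_fps (qexp_coeff q s) * Abs_fps (ratio_coeff a q s)) n)
      = fps_nth g2_fps n"
    by (subst qexp_times_ratio[OF power_q_neq_1 a_power_q_neq_1]) (use q in \<open>auto simp: g2_fps_def\<close>)
  moreover have "complex_of_real (qexp_coeff q s i) = fps_nth (E_q_fps q (-1 / 2)) i" for i
  proof -
    have "(- s) ^ i = (1 - q) ^ i * (-1 / 2) ^ i"
      unfolding s_def by (subst power_mult_distrib[symmetric]) simp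
    then have "qexp_coeff q s i = q ^ (i * (i - 1) div 2) / qfact q i * (-1 / 2) ^ i"
      using q by (simp add: qexp_coeff_def qfact_eq)
    then show ?thesis
      by (simp add: E_q_fps_def)
  qed
  moreover have "complex_of_real (ratio_coeff a q s i) = fps_nth connection_fps i" for i
  proof -
    have "ratio_coeff a q s i = qpoch_ratio q \<alpha> i / 2 ^ i / qfact q i"
      using q by (simp add: ratio_coeff_def qpoch_ratio_eq qfact_eq s_def power_divide)
    then show ?thesis
      by (simp add: connection_fps_def)
  qed
  ultimately show "fps_nth g2_fps n = fps_nth (E_q_fps q (-1 / 2) * connection_fps) n"
    by (simp add: fps_mult_nth)
qed

lemma qBernoulli2_recursion:
  "(\<Sum>k\<le>j. qBernoulli2 q \<alpha> k z * of_real (qbinom q j k * (1 / 2 ^ (j - k)) * qpoch_ratio q \<alpha> (j - k)))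
     = of_real (q ^ (j * (j - 1) div 2)) * z ^ j"
proof -
  define Q where "Q = E_q_fps q z * E_q_fps q (-1 / 2) * inverse g2_fps"
  define B where "B k = fps_nth Q k * of_real (qfact q k)" for k
  have qfact: "qfact q k \<noteq> 0" for k
    using qfact_ge_1[OF q, of k] by simp
  have g2_0: "fps_nth g2_fps 0 \<noteq> 0"
    by (simp add: g2_fps_def bessel_coeff_def)
  define f where "f t = E_q q (z * t) * E_q q (- t / 2) / g2 q \<alpha> (\<i> * t)" for t
  have "(\<lambda>t. E_q q (z * t) * E_q q ((-1 / 2) * t) * inverse (g2 q \<alpha> (\<i> * t))) has_fps_expansion Q"
    unfolding Q_def using g2_0 q
    by (intro has_fps_expansion_mult has_fps_expansion_inverse E_q_has_fps_expansion
        g2_has_fps_expansion)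
  moreover have "(\<lambda>t. E_q q (z * t) * E_q q ((-1 / 2) * t) * inverse (g2 q \<alpha> (\<i> * t))) = f"
    by (simp add: fun_eq_iff f_def inverse_eq_divide)
  ultimately have f: "f has_fps_expansion Q"
    by simp
  define gen where "gen b \<longleftrightarrow> (\<exists>r>0. \<forall>t. norm t < r \<longrightarrow>
      (\<lambda>m. b m * t ^ m / of_real (qfact q m)) sums f t)" for b
  have gen_iff: "gen b \<longleftrightarrow> f has_fps_expansion Abs_fps (\<lambda>m. b m / of_real (qfact q m))" for b
    unfolding gen_def has_fps_expansion_iff_sums by simp
  \<comment> \<open>Uniqueness of expansions makes the definite description pick the normalized
    coefficients of the formal quotient \<open>Q\<close>.\<close>
  have "(THE b. gen b) = B"
  proof (rule the_equality)
    show "gen B"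
      using f qfact by (simp add: gen_iff B_def fps_nth_inverse)
    fix b assume "gen b"
    then have "Abs_fps (\<lambda>m. b m / of_real (qfact q m)) = Q"
      using f unfolding gen_iff by (rule has_fps_expansion_unique)
    then have "fps_nth Q m = b m / of_real (qfact q m)" for m
      by (metis fps_nth_Abs_fps)
    then show "b = B"
      using qfact by (simp add: fun_eq_iff B_def)
  qed
  then have B: "qBernoulli2 q \<alpha> k z = B k" for k
    by (simp add: qBernoulli2_def gen_def[abs_def] f_def)
  have "Q * g2_fps = E_q_fps q z * E_q_fps q (-1 / 2)"
    using inverse_mult_eq_1[OF g2_0] by (simp add: Q_def mult.assoc)
  then have "(Q * connection_fps) * E_q_fps q (-1 / 2) = E_q_fps q z * E_q_fps q (-1 / 2)"
    by (simp add: g2_fps_eq mult_ac)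
  moreover have "fps_nth (E_q_fps q (-1 / 2)) 0 \<noteq> 0"
    by (simp add: E_q_fps_def qfact_def)
  then have "E_q_fps q (-1 / 2) \<noteq> 0"
    by auto
  \<comment> \<open>Formal power series over the complex numbers have no zero divisors, so
    \<open>E_q(- t / 2)\<close> cancels.\<close>
  ultimately have prod: "Q * connection_fps = E_q_fps q z"
    by simp
  \<comment> \<open>Scaling the Cauchy product by \<open>qfact q j\<close> turns the reciprocal
    q-factorials into q-binomial coefficients.\<close>
  have "(\<Sum>k\<le>j. B k * of_real (qbinom q j k * (1 / 2 ^ (j - k)) * qpoch_ratio q \<alpha> (j - k)))
      = (\<Sum>k\<le>j. of_real (qfact q j) * (fps_nth Q k * fps_nth connection_fps (j - k)))"
    using q qfact
    by (intro sum.cong) (simp_all add: B_def connection_fps_def qbinom_eq_qfact mult_ac)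
  also have "\<dots> = of_real (qfact q j) * fps_nth (Q * connection_fps) j"
    by (simp add: fps_mult_nth sum_distrib_left atLeast0AtMost)
  also have "\<dots> = of_real (q ^ (j * (j - 1) div 2)) * z ^ j"
    using qfact by (simp add: prod E_q_fps_def)
  finally show ?thesis
    by (simp only: B)
qed

end

theorem theorem2p5:
  fixes q \<alpha> :: real and n :: nat and z :: complex
  assumes "0 < q" and "q < 1" and "\<alpha> > -1"
  shows "qBernoulli2 q \<alpha> n z = (-1) ^ n * Determinant.det (qBernoulli2_mat q \<alpha> n z)"
proof -
  define t :: "nat \<Rightarrow> nat \<Rightarrow> complex" where
    "t k j = of_real (qbinom q j k * (1 / 2 ^ (j - k)) * qpoch_ratio q \<alpha> (j - k))" for k j
  have "qpoch q q k \<noteq> 0" for k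
    using power_q_neq_1[OF assms, of "Suc _"] by (intro qpoch_nonzero) simp
  then have diag: "t k k = 1" for k
    by (simp add: t_def qbinom_def qpoch_ratio_def)
  have low: "t k j = 0" if "j < k" for k j
    using that by (simp add: t_def qbinom_def)
  \<comment> \<open>For \<open>i \<ge> 1\<close> the truncated differences \<open>j + 1 - i\<close>
    and \<open>j - (i - 1)\<close> agree, also below the subdiagonal.\<close>
  have "qBernoulli2_mat q \<alpha> n z = Matrix.mat (n + 1) (n + 1)
          (\<lambda>(i, j). if i = 0 then of_real (q ^ (j * (j - 1) div 2)) * z ^ j else t (i - 1) j)"
    by (rule eq_matI) (auto simp: qBernoulli2_mat_def t_def)
  then have "Determinant.det (qBernoulli2_mat q \<alpha> n z) = (-1) ^ n * qBernoulli2 q \<alpha> n z"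
    using det_unitriangular_recursion[of t "\<lambda>j. of_real (q ^ (j * (j - 1) div 2)) * z ^ j"
        "\<lambda>k. qBernoulli2 q \<alpha> k z", OF diag low]
      qBernoulli2_recursion[OF assms] by (simp add: t_def)
  then show ?thesis
    by (cases "even n") simp_all
qed

end
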